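(* The $(\mathrm{median},-)$ convolution of two vectors of length $n$ can be computed in $O(n\sqrt{n\lg n})$ time in the nonuniform linear decision tree model.
   Context: For vectors $\vec x=\langle x_0,\dots,x_{n-1}\rangle$, $\vec y=\langle y_0,\dots,y_{n-1}\rangle$ of reals, the $(\mathrm{median},-)$ convolution has $k$th entry $\mathrm{median}_{i=0}^{k}(x_i-y_{k-i})$, $k=0,\dots,n-1$. In the nonuniform linear decision tree model, for each input size there is a separate decision tree whose internal nodes test the sign of a linear function of the input values; the cost is the depth of the tree. *)

theory Defs
  imports Complex_Main
begin

text \<open>Inputs of size n: two vectors x, y given as functions nat => real,
  of which only the entries with index < n are relevant.
  A (homogeneous) linear form on the input is a pair of coefficient vectors (a, b),
  with value  sum_{i<n} a i * x i + b i * y i.\<close>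

type_synonym linform = "(nat \<Rightarrow> real) \<times> (nat \<Rightarrow> real)"

definition lin_val :: "nat \<Rightarrow> linform \<Rightarrow> (nat \<Rightarrow> real) \<Rightarrow> (nat \<Rightarrow> real) \<Rightarrow> real" where
  "lin_val n q x y = (\<Sum>i<n. fst q i * x i + snd q i * y i)"

datatype ldt = Leaf "linform list" | Node linform ldt ldt ldt

fun ldt_eval :: "nat \<Rightarrow> ldt \<Rightarrow> (nat \<Rightarrow> real) \<Rightarrow> (nat \<Rightarrow> real) \<Rightarrow> real list" where
  "ldt_eval n (Leaf outs) x y = map (\<lambda>q. lin_val n q x y) outs"
| "ldt_eval n (Node q tn tz tp) x y =
     (if lin_val n q x y < 0 then ldt_eval n tn x y
      else if lin_val n q x y = 0 then ldt_eval n tz x y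
      else ldt_eval n tp x y)"

fun ldt_depth :: "ldt \<Rightarrow> nat" where
  "ldt_depth (Leaf _) = 0"
| "ldt_depth (Node _ tn tz tp) = 1 + max (ldt_depth tn) (max (ldt_depth tz) (ldt_depth tp))"

text \<open>Median of a nonempty list: the lower median, i.e. the element of (0-based)
  rank (m-1) div 2 in sorted order, where m is the length.\<close>

definition median :: "real list \<Rightarrow> real" where
  "median xs = sort xs ! ((length xs - 1) div 2)"

definition median_minus_conv :: "nat \<Rightarrow> (nat \<Rightarrow> real) \<Rightarrow> (nat \<Rightarrow> real) \<Rightarrow> real list" where
  "median_minus_conv n x y = map (\<lambda>k. median (map (\<lambda>i. x i - y (k - i)) [0..<Suc k])) [0..<n]"

definition ldt_computes :: "nat \<Rightarrow> ldt \<Rightarrow> ((nat \<Rightarrow> real) \<Rightarrow> (nat \<Rightarrow> real) \<Rightarrow> real list) \<Rightarrow> bool" where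
  "ldt_computes n T f \<longleftrightarrow> (\<forall>x y. ldt_eval n T x y = f x y)"

end

theory Submission
  imports Defs
begin

text \<open>
  All comparisons made are signs of a fixed family of polynomially many linear forms in \<open>2n\<close>
  variables, so only \<open>n\<close> to the \<open>O(n)\<close> sign vectors occur. Call a sign of a form predicted
  on the current set of inputs if it fails for less than a third of the remaining sign vectors. A query
  of a form without predicted sign, or one that contradicts a prediction, leaves at most two thirds
  of the sign vectors; this happens at most \<open>g = O(n lg n)\<close> times. Otherwise the predicted
  comparisons form a linear preorder, from which the result of a task (inserting an element into a
  sorted list, or finding the median of a row) can be read off, and only verified. If
  verification takes at most \<open>c\<close> queries, then \<open>N\<close> tasks cost at most \<open>c (N + g)\<close>.

  With blocks of length \<open>d\<close>, sorting the \<open>O(nd)\<close> differences of entries of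
  \<open>x\<close> or of \<open>y\<close> at distance less than \<open>d\<close> has \<open>c = 3\<close>. By Fredman's trick this sorts every
  block of every row, after which the predicted median of a row is verified with three queries per
  block, that is \<open>c = O(n/d)\<close>. The choice \<open>d = sqrt (n lg n)\<close> balances the two phases.
\<close>

section \<open>Decision trees as refinements of point sets\<close>

text \<open>Trees stay implicit: some tree of depth at most \<open>t\<close> with queries from
  \<open>F\<close> splits the input set \<open>X\<close> into leaf sets satisfying \<open>P\<close>.
  Tracking sets of inputs allows counting the sign vectors that are still possible.\<close>

inductive dec :: "('p \<Rightarrow> real) set \<Rightarrow> ('p set \<Rightarrow> bool) \<Rightarrow> nat \<Rightarrow> 'p set \<Rightarrow> bool" for F P where
  dec_stop: "P X \<Longrightarrow> dec F P t X"
| dec_query: "f \<in> F \<Longrightarrow> (\<And>s. s \<in> {-1, 0, 1} \<Longrightarrow> dec F P t {p \<in> X. sgn (f p) = s}) \<Longrightarrow> dec F P (Suc t) X"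

lemma dec_mono: "dec F P t X \<Longrightarrow> t \<le> t' \<Longrightarrow> dec F P t' X"
proof (induction arbitrary: t' rule: dec.induct)
  case (dec_stop X t)
  from dec_stop(1) show ?case by (rule dec.dec_stop)
next
  case (dec_query f t X)
  then obtain u where u: "t' = Suc u" "t \<le> u" by (cases t') auto
  show ?case unfolding u(1)
    by (rule dec.dec_query[OF dec_query.hyps(1)]) (use dec_query.IH u(2) in blast)
qed

text \<open>Sequential composition: a second tree is grafted onto every leaf of the first. With
  \<open>t = 0\<close> it weakens the stopping predicate.\<close>

lemma dec_bind:
  assumes "dec F P s X" "\<And>Y. P Y \<Longrightarrow> dec F R t Y"
  shows "dec F R (s + t) X"
  using assms
proof (induction rule: dec.induct)
  case (dec_stop X s)
  show ?case by (rule dec_mono[OF dec_stop(2)[OF dec_stop(1)]]) simp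
next
  case (dec_query f s X)
  show ?case unfolding add_Suc
    by (rule dec.dec_query[OF dec_query.hyps(1)]) (use dec_query.IH dec_query.prems in blast)
qed

section \<open>Linear forms as queries\<close>

definition linear_queries :: "nat \<Rightarrow> ((nat \<Rightarrow> real) \<times> (nat \<Rightarrow> real) \<Rightarrow> real) set" where
  "linear_queries n = {f. \<exists>q. \<forall>x y. f (x, y) = lin_val n q x y}"

lemma linear_queries_diff:
  assumes "f \<in> linear_queries n" "g \<in> linear_queries n"
  shows "(\<lambda>p. f p - g p) \<in> linear_queries n"
proof -
  obtain a b where "\<forall>x y. f (x, y) = lin_val n a x y" "\<forall>x y. g (x, y) = lin_val n b x y"
    using assms by (auto simp: linear_queries_def)
  then have "\<forall>x y. f (x, y) - g (x, y) =
      lin_val n (\<lambda>i. fst a i - fst b i, \<lambda>i. snd a i - snd b i) x y"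
    by (simp add: lin_val_def algebra_simps sum.distrib sum_subtractf)
  then show ?thesis by (auto simp: linear_queries_def)
qed

lemma linear_queries_fst:
  assumes "i < n" shows "(\<lambda>p. fst p i) \<in> linear_queries n"
proof -
  have "x i = lin_val n (\<lambda>j. of_bool (j = i), \<lambda>_. 0) x y" for x y
    using assms by (simp add: lin_val_def sum.remove[of "{..<n}" i])
  then show ?thesis unfolding linear_queries_def by auto
qed

lemma linear_queries_snd:
  assumes "i < n" shows "(\<lambda>p. snd p i) \<in> linear_queries n"
proof -
  have "y i = lin_val n (\<lambda>_. 0, \<lambda>j. of_bool (j = i)) x y" for x y
    using assms by (simp add: lin_val_def sum.remove[of "{..<n}" i])
  then show ?thesis unfolding linear_queries_def by auto
qed

text \<open>A leaf outputs a fixed list of linear forms, so it is correct as soon as one such list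
  gives the right values on its whole input set.\<close>

lemma dec_imp_ldt:
  assumes "dec (linear_queries n)
    (\<lambda>Y. \<exists>outs. \<forall>(x, y)\<in>Y. f x y = map (\<lambda>q. lin_val n q x y) outs) t X"
  shows "\<exists>T. ldt_depth T \<le> t \<and> (\<forall>(x, y)\<in>X. ldt_eval n T x y = f x y)"
  using assms
proof (induction rule: dec.induct)
  case (dec_stop X t)
  then obtain outs where "\<forall>(x, y)\<in>X. f x y = map (\<lambda>q. lin_val n q x y) outs" by blast
  then show ?case by (intro exI[of _ "Leaf outs"]) auto
next
  case (dec_query h t X)
  obtain q where q: "\<And>x y. h (x, y) = lin_val n q x y"
    using dec_query(1) by (auto simp: linear_queries_def)
  have "\<forall>s\<in>{-1, 0, 1::real}. \<exists>T. ldt_depth T \<le> t \<and>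
      (\<forall>(x, y)\<in>{p \<in> X. sgn (h p) = s}. ldt_eval n T x y = f x y)"
    using dec_query.IH by blast
  from bchoice[OF this] obtain T where T: "\<And>s. s \<in> {-1, 0, 1::real} \<Longrightarrow> ldt_depth (T s) \<le> t"
    "\<And>s x y. s \<in> {-1, 0, 1::real} \<Longrightarrow> (x, y) \<in> X \<Longrightarrow> sgn (h (x, y)) = s \<Longrightarrow> ldt_eval n (T s) x y = f x y"
    by fastforce
  show ?case
  proof (intro exI conjI)
    show "ldt_depth (Node q (T (-1)) (T 0) (T 1)) \<le> Suc t"
      using T(1) by simp
    show "\<forall>(x, y)\<in>X. ldt_eval n (Node q (T (-1)) (T 0) (T 1)) x y = f x y"
      using T(2)[of "-1"] T(2)[of 0] T(2)[of 1] by (auto simp: q sgn_if)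
  qed
qed

section \<open>Counting sign vectors\<close>

text \<open>For linear forms, the values of \<open>sig fs\<close> on \<open>X\<close> are the faces,
  of all dimensions, of the hyperplane arrangement \<open>fs\<close> that meet
  \<open>X\<close>.\<close>

definition sig :: "('p \<Rightarrow> real) list \<Rightarrow> 'p \<Rightarrow> real list" where
  "sig fs p = map (\<lambda>f. sgn (f p)) fs"

lemma finite_sig [simp]: "finite (sig fs ` X)"
proof (rule finite_subset)
  show "sig fs ` X \<subseteq> {xs. set xs \<subseteq> {-1, 0, 1} \<and> length xs = length fs}"
    by (auto simp: sig_def sgn_if)
qed (simp add: finite_lists_length_eq)

lemma sgn_positive_combination:
  fixes a b s t :: real
  assumes "sgn a = sgn b" "s > 0" "t > 0"
  shows "sgn (s * a + t * b) = sgn a"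
proof -
  consider "a > 0" "b > 0" | "a = 0" "b = 0" | "a < 0" "b < 0"
    using assms(1) by (auto simp: sgn_if split: if_splits)
  then show ?thesis
  proof cases
    case 1 then have "s * a + t * b > 0" using assms by (simp add: add_pos_pos)
    then show ?thesis using 1 by simp
  next
    case 3 then have "s * a + t * b < 0" using assms by (simp add: add_neg_neg mult_pos_neg)
    then show ?thesis using 3 by simp
  qed auto
qed

text \<open>Deletion and restriction: a sign vector of \<open>fs\<close> seen on both open sides of
  \<open>f\<close> is also seen on \<open>f = 0\<close>, so adding \<open>f\<close> adds at most
  twice the count on that hyperplane, where one of the spanning functions is lost. The base
  \<open>2 * length fs + 1\<close> absorbs the factor two. The last hypothesis stands in for
  \<open>X\<close> being a convex cone, as far as the forms can see, and survives restriction to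
  \<open>f = 0\<close>.\<close>

lemma card_sig_le:
  fixes g :: "'j \<Rightarrow> 'p \<Rightarrow> real"
  assumes "finite J"
    and "\<And>f. f \<in> set fs \<Longrightarrow> \<exists>c. \<forall>p\<in>X. f p = (\<Sum>j\<in>J. c j * g j p)"
    and "\<And>p q s t. p \<in> X \<Longrightarrow> q \<in> X \<Longrightarrow> s > 0 \<Longrightarrow> t > 0 \<Longrightarrow>
           \<exists>r\<in>X. \<forall>f\<in>set fs. f r = s * f p + t * f q"
  shows "card (sig fs ` X) \<le> (2 * length fs + 1) ^ card J"
  using assms
proof (induction fs arbitrary: X J)
  case Nil
  have "card (sig [] ` X) \<le> card {[] :: real list}"
    by (rule card_mono) (auto simp: sig_def)
  then show ?case by simp
next
  case (Cons f fs)
  let ?m = "length fs"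
  define H where "H = {p \<in> X. f p = 0}"
  define B where "B s = sig fs ` {p \<in> X. sgn (f p) = s}" for s
  have fin: "finite (B s)" for s by (simp add: B_def)
  have span: "\<exists>c. \<forall>p\<in>X. h p = (\<Sum>j\<in>J. c j * g j p)" if "h \<in> set fs" for h
    using Cons.prems(2) that by simp
  have comb: "\<exists>r\<in>X. \<forall>h\<in>set fs. h r = s * h p + t * h q"
    if "p \<in> X" "q \<in> X" "s > 0" "t > 0" for p q s t
    using Cons.prems(3)[OF that] by auto
  have IH: "card (sig fs ` X) \<le> (2 * ?m + 1) ^ card J"
    by (rule Cons.IH[OF Cons.prems(1) span comb])
  obtain c where c: "\<And>p. p \<in> X \<Longrightarrow> f p = (\<Sum>j\<in>J. c j * g j p)"
    using Cons.prems(2)[of f] by auto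
  show ?case
  proof (cases "\<exists>j\<in>J. c j \<noteq> 0")
    case False
    then have z: "f p = 0" if "p \<in> X" for p using c[OF that] by simp
    have "sig (f # fs) ` X = (#) 0 ` sig fs ` X"
      unfolding image_image by (rule image_cong) (simp_all add: sig_def z)
    then have "card (sig (f # fs) ` X) \<le> card (sig fs ` X)"
      by (simp add: card_image_le)
    also note IH
    also have "(2 * ?m + 1) ^ card J \<le> (2 * length (f # fs) + 1) ^ card J"
      by (rule power_mono) auto
    finally show ?thesis .
  next
    case True
    then obtain j where j: "j \<in> J" "c j \<noteq> 0" by blast
    have J: "card J = Suc (card J - 1)"
      using j(1) Cons.prems(1) card_gt_0_iff[of J] by auto
    have "card (sig fs ` H) \<le> (2 * ?m + 1) ^ card (J - {j})"
    proof (rule Cons.IH)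
      show "finite (J - {j})" using Cons.prems(1) by simp
    next
      fix h assume "h \<in> set fs"
      then obtain e where e: "\<And>p. p \<in> X \<Longrightarrow> h p = (\<Sum>i\<in>J. e i * g i p)"
        using span by blast
      \<comment> \<open>On \<open>f = 0\<close> the function \<open>g j\<close> is a combination of
        the others, because \<open>c j \<noteq> 0\<close>, and can be eliminated.\<close>
      have "h p = (\<Sum>i\<in>J - {j}. (e i - e j / c j * c i) * g i p)" if "p \<in> H" for p
      proof -
        have p: "p \<in> X" "f p = 0" using that by (auto simp: H_def)
        have 1: "c j * g j p = - (\<Sum>i\<in>J - {j}. c i * g i p)"
          using c[OF p(1)] p(2) sum.remove[OF Cons.prems(1) j(1), of "\<lambda>i. c i * g i p"] by simp
        have "h p = e j / c j * (c j * g j p) + (\<Sum>i\<in>J - {j}. e i * g i p)"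
          using e[OF p(1)] sum.remove[OF Cons.prems(1) j(1), of "\<lambda>i. e i * g i p"] j(2) by simp
        also have "\<dots> = (\<Sum>i\<in>J - {j}. (e i - e j / c j * c i) * g i p)"
          unfolding 1 by (simp add: left_diff_distrib sum_subtractf sum_distrib_left mult.assoc)
        finally show ?thesis .
      qed
      then show "\<exists>c. \<forall>p\<in>H. h p = (\<Sum>j\<in>J - {j}. c j * g j p)"
        by (intro exI[of _ "\<lambda>i. e i - e j / c j * c i"]) blast
    next
      fix p q and s t :: real
      assume "p \<in> H" "q \<in> H" "s > 0" "t > 0"
      then show "\<exists>r\<in>H. \<forall>h\<in>set fs. h r = s * h p + t * h q"
        using Cons.prems(3)[of p q s t] by (auto simp: H_def)
    qed
    then have H: "card (B 0) \<le> (2 * ?m + 1) ^ (card J - 1)"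
      using j(1) Cons.prems(1) by (simp add: B_def H_def sgn_0_0)
    have "B 1 \<inter> B (-1) \<subseteq> B 0"
    proof
      fix \<sigma> assume "\<sigma> \<in> B 1 \<inter> B (-1)"
      then obtain p q where pq: "p \<in> X" "q \<in> X" "f p > 0" "f q < 0" "\<sigma> = sig fs p" "\<sigma> = sig fs q"
        by (auto simp: B_def sgn_1_pos sgn_1_neg)
      \<comment> \<open>The weights \<open>- f q\<close> and \<open>f p\<close> are positive and
        make \<open>f\<close> vanish; the forms in \<open>fs\<close> keep their signs because
        \<open>p\<close> and \<open>q\<close> have the same sign vector.\<close>
      obtain r where r: "r \<in> X" "\<forall>h\<in>set (f # fs). h r = - f q * h p + f p * h q"
        using Cons.prems(3)[OF pq(1,2), of "- f q" "f p"] pq(3,4) by auto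
      have "sgn (h r) = sgn (h p)" if "h \<in> set fs" for h
      proof -
        have "sgn (h p) = sgn (h q)"
          using pq(5,6) that by (auto simp: sig_def)
        then show ?thesis
          using sgn_positive_combination[of "h p" "h q" "- f q" "f p"] r(2) that pq(3,4) by simp
      qed
      then have "sig fs r = \<sigma>" using pq(5) by (simp add: sig_def)
      then show "\<sigma> \<in> B 0" using r by (auto simp: B_def)
    qed
    then have "card (B 1 \<inter> B (-1)) \<le> card (B 0)" by (rule card_mono[OF fin])
    moreover have "card (B 1) + card (B (-1)) = card (B 1 \<union> B (-1)) + card (B 1 \<inter> B (-1))"
      by (rule card_Un_Int[OF fin fin])
    moreover have "card (B 1 \<union> B (-1)) \<le> card (sig fs ` X)"
      by (rule card_mono) (auto simp: B_def)
    ultimately have pm: "card (B 1) + card (B (-1)) \<le> card (sig fs ` X) + card (B 0)" by linarith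
    have "sig (f # fs) ` X \<subseteq> ((#) 0 ` B 0 \<union> (#) 1 ` B 1) \<union> (#) (-1) ` B (-1)"
    proof
      fix \<sigma> assume "\<sigma> \<in> sig (f # fs) ` X"
      then obtain p where p: "p \<in> X" "\<sigma> = sgn (f p) # sig fs p" by (auto simp: sig_def)
      then have "\<sigma> \<in> (#) (sgn (f p)) ` B (sgn (f p))" by (auto simp: B_def)
      moreover have "sgn (f p) = 0 \<or> sgn (f p) = 1 \<or> sgn (f p) = -1" by (simp add: sgn_if)
      ultimately show "\<sigma> \<in> ((#) 0 ` B 0 \<union> (#) 1 ` B 1) \<union> (#) (-1) ` B (-1)"
        by (metis UnI1 UnI2)
    qed
    then have "card (sig (f # fs) ` X) \<le> card (((#) 0 ` B 0 \<union> (#) 1 ` B 1) \<union> (#) (-1) ` B (-1))"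
      by (rule card_mono[rotated]) (simp add: fin)
    also have "\<dots> \<le> card (B 0) + card (B 1) + card (B (-1))"
      by (meson add_mono card_Un_le card_image_le fin order_trans)
    also have "\<dots> \<le> (2 * ?m + 1) ^ card J + 2 * (2 * ?m + 1) ^ (card J - 1)"
      using pm IH H by linarith
    also have "\<dots> = (2 * ?m + 3) * (2 * ?m + 1) ^ (card J - 1)"
      by (subst J) (simp add: algebra_simps)
    also have "\<dots> \<le> (2 * ?m + 3) * (2 * ?m + 3) ^ (card J - 1)"
      by (intro mult_left_mono power_mono) auto
    also have "\<dots> = (2 * ?m + 3) ^ card J"
      by (subst (2) J) simp
    also have "2 * ?m + 3 = 2 * length (f # fs) + 1" by simp
    finally show ?thesis .
  qed
qed

text \<open>The \<open>2 * n\<close> input entries are the spanning functions; the disjoint sum of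
  index sets keeps the two vectors apart.\<close>

lemma card_sig_linear:
  assumes "set fs \<subseteq> linear_queries n"
  shows "card (sig fs ` UNIV) \<le> (2 * length fs + 1) ^ (2 * n)"
proof -
  let ?J = "{..<n} <+> {..<n}"
  let ?g = "\<lambda>j p. case j of Inl i \<Rightarrow> fst p i | Inr i \<Rightarrow> (snd p i :: real)"
  have "card (sig fs ` UNIV) \<le> (2 * length fs + 1) ^ card ?J"
  proof (rule card_sig_le[where g = ?g])
    fix f assume "f \<in> set fs"
    then obtain a where a: "\<And>x y. f (x, y) = lin_val n a x y"
      using assms by (auto simp: linear_queries_def)
    have "f p = (\<Sum>j\<in>?J. (case j of Inl i \<Rightarrow> fst a i | Inr i \<Rightarrow> snd a i) * ?g j p)" for p
      by (cases p) (simp add: a lin_val_def sum.Plus sum.distrib)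
    then show "\<exists>c. \<forall>p\<in>UNIV. f p = (\<Sum>j\<in>?J. c j * ?g j p)"
      by (intro exI[of _ "\<lambda>j. case j of Inl i \<Rightarrow> fst a i | Inr i \<Rightarrow> snd a i"]) blast
  next
    fix p q :: "(nat \<Rightarrow> real) \<times> (nat \<Rightarrow> real)" and s t :: real
    have "f (\<lambda>i. s * fst p i + t * fst q i, \<lambda>i. s * snd p i + t * snd q i) = s * f p + t * f q"
      if "f \<in> set fs" for f
    proof -
      obtain a where a: "\<And>x y. f (x, y) = lin_val n a x y"
        using assms \<open>f \<in> set fs\<close> by (auto simp: linear_queries_def)
      show ?thesis
        by (cases p; cases q)
          (simp add: a lin_val_def algebra_simps sum.distrib sum_distrib_left)
    qed
    then show "\<exists>r\<in>UNIV. \<forall>f\<in>set fs. f r = s * f p + t * f q" by blast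
  qed simp
  then show ?thesis by (simp add: card_Plus mult_2)
qed

section \<open>Predicted signs\<close>

definition predicted :: "('p \<Rightarrow> real) list \<Rightarrow> 'p set \<Rightarrow> ('p \<Rightarrow> real) \<Rightarrow> real \<Rightarrow> bool" where
  "predicted fs X f s \<longleftrightarrow> 3 * card (sig fs ` {p \<in> X. sgn (f p) \<noteq> s}) < card (sig fs ` X)"

text \<open>Union bound: three exceptional sets, each with fewer than a third of the sign vectors,
  cannot cover all of them. Three is the number of comparisons in a transitivity law.\<close>

lemma predicted_realised:
  assumes "predicted fs X f s" "predicted fs X g t" "predicted fs X h u"
  shows "\<exists>p\<in>X. sgn (f p) = s \<and> sgn (g p) = t \<and> sgn (h p) = u"
proof (rule ccontr)
  assume neg: "\<not> ?thesis"
  let ?A = "\<lambda>f s. sig fs ` {p \<in> X. sgn (f p) \<noteq> s}"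
  have "sig fs ` X \<subseteq> (?A f s \<union> ?A g t) \<union> ?A h u" using neg by auto
  then have "card (sig fs ` X) \<le> card ((?A f s \<union> ?A g t) \<union> ?A h u)"
    by (rule card_mono[rotated]) simp
  also have "\<dots> \<le> card (?A f s) + card (?A g t) + card (?A h u)"
    by (meson add_mono card_Un_le order_refl order_trans)
  finally show False using assms unfolding predicted_def by linarith
qed

text \<open>As \<open>f\<close> belongs to \<open>fs\<close>, a sign vector determines the sign of
  \<open>f\<close>. So the exceptions, at least a third of the sign vectors, are disjoint from the
  rest.\<close>

lemma card_sig_if_not_predicted:
  assumes "f \<in> set fs" "\<not> predicted fs X f s"
  shows "3 * card (sig fs ` {p \<in> X. sgn (f p) = s}) \<le> 2 * card (sig fs ` X)"
proof -
  let ?A = "sig fs ` {p \<in> X. sgn (f p) = s}" and ?B = "sig fs ` {p \<in> X. sgn (f p) \<noteq> s}"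
  have "?A \<inter> ?B = {}" using assms(1) by (auto simp: sig_def)
  moreover have "sig fs ` X = ?A \<union> ?B" by auto
  ultimately have "card (sig fs ` X) = card ?A + card ?B" by (simp add: card_Un_disjoint)
  then show ?thesis using assms(2) unfolding predicted_def by linarith
qed

text \<open>Only exceptions remain, fewer than a third. The weaker bound puts both kinds of failure
  under one rule.\<close>

lemma card_sig_if_mispredicted:
  assumes "predicted fs X f s" "u \<noteq> s"
  shows "3 * card (sig fs ` {p \<in> X. sgn (f p) = u}) \<le> 2 * card (sig fs ` X)"
proof -
  have "card (sig fs ` {p \<in> X. sgn (f p) = u}) \<le> card (sig fs ` {p \<in> X. sgn (f p) \<noteq> s})"
    using assms(2) by (intro card_mono) auto
  then show ?thesis using assms(1) unfolding predicted_def by linarith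
qed

section \<open>Amortised cost of verifying predictions\<close>

text \<open>The hypothesis on \<open>g\<close> bounds the sign vectors left by
  \<open>(3/2)^g\<close>, so \<open>g\<close> bounds the failures still possible. The budget is
  \<open>c\<close> per remaining task and per remaining failure: a confirmed list \<open>L\<close>
  finishes task \<open>\<tau>\<close>, a failure lowers \<open>g\<close> and restarts the task.
  Finished tasks stay finished by \<open>sub\<close>; \<open>Z\<close> carries what earlier phases
  established.\<close>

lemma predicted_amortised:
  fixes P :: "nat \<Rightarrow> 'p set \<Rightarrow> bool"
  assumes fs: "set fs \<subseteq> F" and c: "c \<ge> 1"
    and empty: "\<And>\<tau>. P \<tau> {}"
    and sub: "\<And>\<tau> X Y. P \<tau> X \<Longrightarrow> Y \<subseteq> X \<Longrightarrow> P \<tau> Y"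
    and step: "\<And>X \<tau>. \<tau> < N \<Longrightarrow> X \<subseteq> Z \<Longrightarrow> X \<noteq> {} \<Longrightarrow> (\<forall>\<sigma><\<tau>. P \<sigma> X) \<Longrightarrow>
      (\<forall>f\<in>set fs. \<exists>s. predicted fs X f s) \<Longrightarrow>
      \<exists>L. length L \<le> c \<and> (\<forall>(f, s)\<in>set L. f \<in> set fs \<and> predicted fs X f s) \<and>
          P \<tau> {p \<in> X. \<forall>(f, s)\<in>set L. sgn (f p) = s}"
    and "\<tau> \<le> N" "X \<subseteq> Z" "\<forall>\<sigma><\<tau>. P \<sigma> X" "card (sig fs ` X) * 2 ^ g \<le> 3 ^ g"
  shows "dec F (\<lambda>Y. \<forall>\<sigma><N. P \<sigma> Y) (c * (N - \<tau> + g)) X"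
  using assms(6-)
proof (induction "N - \<tau> + g" arbitrary: \<tau> g X rule: less_induct)
  case less
  let ?dec = "dec F (\<lambda>Y. \<forall>\<sigma><N. P \<sigma> Y)"
  \<comment> \<open>A nonempty \<open>Y\<close> has a sign vector, hence \<open>X\<close> has at
    least two, which excludes \<open>g = 0\<close>; otherwise the loss of a third lowers
    \<open>g\<close> by one.\<close>
  have shrink: "?dec (c * (N - \<tau> + (g - 1))) Y \<and> g \<ge> 1 \<or> Y = {}"
    if Y: "Y \<subseteq> X" "3 * card (sig fs ` Y) \<le> 2 * card (sig fs ` X)" for Y
  proof (cases "Y = {}")
    case False
    then have "card (sig fs ` Y) \<ge> 1"
      by (simp add: Suc_le_eq card_gt_0_iff)
    then have "g \<noteq> 0" using Y(2) less.prems(4) by (intro notI) simp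
    then obtain h where h: "g = Suc h" by (cases g) auto
    have "card (sig fs ` Y) * 2 ^ h \<le> 3 ^ h"
    proof -
      have "3 * card (sig fs ` Y) * 2 ^ h \<le> 2 * card (sig fs ` X) * 2 ^ h"
        using Y(2) by (rule mult_right_mono) simp
      also have "\<dots> \<le> 3 * 3 ^ h"
        using less.prems(4) by (simp add: h mult.left_commute mult.commute)
      finally show ?thesis by simp
    qed
    moreover have "\<forall>\<sigma><\<tau>. P \<sigma> Y" "Y \<subseteq> Z"
      using less.prems(2,3) sub Y(1) by blast+
    ultimately have "?dec (c * (N - \<tau> + h)) Y"
      using h less.prems(1) by (intro less.hyps) auto
    then show ?thesis by (simp add: h)
  qed simp
  have dec_empty: "?dec t {}" for t by (rule dec_stop) (simp add: empty)
  consider "\<tau> = N \<or> X = {}" | "\<tau> < N" "X \<noteq> {}" "\<exists>f\<in>set fs. \<forall>s. \<not> predicted fs X f s"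
    | "\<tau> < N" "X \<noteq> {}" "\<forall>f\<in>set fs. \<exists>s. predicted fs X f s"
    using less.prems(1) by (cases "\<tau> = N") auto
  then show ?case
  proof cases
    case 1
    then show ?thesis using less.prems(3) empty by (intro dec_stop) auto
  next
    case 2
    then obtain f where f: "f \<in> set fs" "\<And>s. \<not> predicted fs X f s" by blast
    \<comment> \<open>No sign of \<open>f\<close> is predicted, so every answer is a failure, and
      the \<open>c \<ge> 1\<close> units it releases pay for this query.\<close>
    define t where "t = c * (N - \<tau> + g) - 1"
    have t: "c * (N - \<tau> + g) = Suc t" using 2(1) c by (simp add: t_def)
    show ?thesis unfolding t
    proof (rule dec_query)
      show "f \<in> F" using f(1) fs by blast
      fix s :: real
      have "?dec (c * (N - \<tau> + (g - 1))) {p \<in> X. sgn (f p) = s} \<and> g \<ge> 1 \<or> {p \<in> X. sgn (f p) = s} = {}"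
        by (rule shrink[OF _ card_sig_if_not_predicted[OF f]]) blast
      then show "?dec t {p \<in> X. sgn (f p) = s}"
      proof
        assume *: "?dec (c * (N - \<tau> + (g - 1))) {p \<in> X. sgn (f p) = s} \<and> g \<ge> 1"
        then have "N - \<tau> + g = Suc (N - \<tau> + (g - 1))" by simp
        then have "c * (N - \<tau> + g) = c + c * (N - \<tau> + (g - 1))" by (metis mult_Suc_right)
        then have "c * (N - \<tau> + (g - 1)) \<le> t" using c t by linarith
        then show ?thesis using * dec_mono by blast
      next
        assume "{p \<in> X. sgn (f p) = s} = {}"
        then show ?thesis using dec_empty by metis
      qed
    qed
  next
    case 3
    obtain L where L: "length L \<le> c" "\<forall>(f, s)\<in>set L. f \<in> set fs \<and> predicted fs X f s"
      "P \<tau> {p \<in> X. \<forall>(f, s)\<in>set L. sgn (f p) = s}"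
      using step[OF 3(1) less.prems(2) 3(2) less.prems(3) 3(3)] by blast
    define t where "t = c * (N - Suc \<tau> + g)"
    \<comment> \<open>\<open>Y\<close> is the part of \<open>X\<close> consistent with the answers
      so far, while the predictions remain those for \<open>X\<close>. A wrong answer is measured
      against \<open>X\<close>, so it is a failure at any position of \<open>L\<close>.\<close>
    have walk: "?dec (length L' + t) Y"
      if "Y \<subseteq> X" "set L' \<subseteq> set L" "P \<tau> {p \<in> Y. \<forall>(f, s)\<in>set L'. sgn (f p) = s}" for L' Y
      using that
    proof (induction L' arbitrary: Y)
      case Nil
      have "\<forall>\<sigma><Suc \<tau>. P \<sigma> Y"
        using Nil(3) less.prems(3) sub[OF _ Nil(1)] by (simp add: less_Suc_eq)
      moreover have "card (sig fs ` Y) \<le> card (sig fs ` X)"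
        using Nil(1) by (intro card_mono) auto
      then have "card (sig fs ` Y) * 2 ^ g \<le> 3 ^ g"
        using less.prems(4) by (meson mult_right_mono le0 order_trans)
      ultimately have "?dec t Y"
        unfolding t_def using 3(1) less.prems(2) Nil(1)
        by (intro less.hyps) auto
      then show ?case by simp
    next
      case (Cons a L')
      obtain f s where a: "a = (f, s)" by (cases a)
      have fp: "f \<in> set fs" "predicted fs X f s" using Cons.prems(2) L(2) by (auto simp: a)
      have "?dec (Suc (length L' + t)) Y"
      proof (rule dec_query)
        show "f \<in> F" using fp(1) fs by blast
        fix u :: real
        show "?dec (length L' + t) {p \<in> Y. sgn (f p) = u}"
        proof (cases "u = s")
          case True
          have eq: "{p \<in> {p \<in> Y. sgn (f p) = s}. \<forall>(f, s)\<in>set L'. sgn (f p) = s} =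
              {p \<in> Y. \<forall>(f, s)\<in>set (a # L'). sgn (f p) = s}"
            by (auto simp: a)
          show ?thesis unfolding True
            by (rule Cons.IH, use Cons.prems(1) in blast, use Cons.prems(2) in simp,
              use Cons.prems(3) in \<open>simp only: eq\<close>)
        next
          case False
          have "card (sig fs ` {p \<in> Y. sgn (f p) = u}) \<le> card (sig fs ` {p \<in> X. sgn (f p) = u})"
            using Cons.prems(1) by (intro card_mono) auto
          then have "3 * card (sig fs ` {p \<in> Y. sgn (f p) = u}) \<le> 2 * card (sig fs ` X)"
            using card_sig_if_mispredicted[OF fp(2) False] by linarith
          then have "?dec (c * (N - \<tau> + (g - 1))) {p \<in> Y. sgn (f p) = u} \<and> g \<ge> 1 \<or> {p \<in> Y. sgn (f p) = u} = {}"
            using Cons.prems(1) by (intro shrink) auto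
          then show ?thesis
          proof
            assume *: "?dec (c * (N - \<tau> + (g - 1))) {p \<in> Y. sgn (f p) = u} \<and> g \<ge> 1"
            \<comment> \<open>A failure and a finished task lower the potential equally, so the same
              budget \<open>t\<close> remains.\<close>
            then have "c * (N - \<tau> + (g - 1)) = t" using 3(1) by (simp add: t_def)
            then have "?dec t {p \<in> Y. sgn (f p) = u}" using * by metis
            then show ?thesis by (rule dec_mono) simp
          next
            assume "{p \<in> Y. sgn (f p) = u} = {}"
            then show ?thesis using dec_empty by metis
          qed
        qed
      qed
      then show ?case by simp
    qed
    have "?dec (length L + t) X" by (rule walk) (use L(3) in auto)
    moreover have "N - \<tau> + g = Suc (N - Suc \<tau> + g)" using 3(1) by simp
    then have "c * (N - \<tau> + g) = c + t" by (metis mult_Suc_right t_def)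
    ultimately show ?thesis using L(1) dec_mono[of F _ "length L + t" X "c + t"] by simp
  qed
qed

section \<open>Linear preorders from predicted signs\<close>

definition sign_constant :: "'p set \<Rightarrow> ('p \<Rightarrow> real) \<Rightarrow> bool" where
  "sign_constant X f \<longleftrightarrow> (\<exists>s. \<forall>p\<in>X. sgn (f p) = s)"

lemma sign_constant_empty [simp]: "sign_constant {} f"
  by (simp add: sign_constant_def)

lemma sign_constant_subset: "sign_constant X f \<Longrightarrow> Y \<subseteq> X \<Longrightarrow> sign_constant Y f"
  unfolding sign_constant_def by blast

lemma sign_constant_swap:
  assumes "sign_constant X (\<lambda>p. v p - w p)"
  shows "sign_constant X (\<lambda>p. w p - v p)"
proof -
  obtain s where "\<forall>p\<in>X. sgn (v p - w p) = s"
    using assms by (auto simp: sign_constant_def)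
  then have "\<forall>p\<in>X. sgn (w p - v p) = - s"
    by (metis minus_diff_eq sgn_minus)
  then show ?thesis by (auto simp: sign_constant_def)
qed

text \<open>Any three predicted signs occur together at some point, so the predicted comparisons
  satisfy every law of linear orders that involves at most three elements.\<close>

lemma predicted_order:
  fixes v :: "'i \<Rightarrow> 'p \<Rightarrow> real"
  assumes "finite R"
    and "\<And>i j. i \<in> R \<Longrightarrow> j \<in> R \<Longrightarrow> \<exists>s. predicted fs X (\<lambda>p. v i p - v j p) s"
  shows "\<exists>w :: 'i \<Rightarrow> real. \<forall>i\<in>R. \<forall>j\<in>R. predicted fs X (\<lambda>p. v i p - v j p) (sgn (w i - w j))"
proof -
  define s where "s i j = (SOME s. predicted fs X (\<lambda>p. v i p - v j p) s)" for i j
  have s: "predicted fs X (\<lambda>p. v i p - v j p) (s i j)" if "i \<in> R" "j \<in> R" for i j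
    unfolding s_def by (rule someI_ex[OF assms(2)[OF that]])
  have real: "\<exists>p\<in>X. sgn (v i p - v j p) = s i j \<and> sgn (v j p - v k p) = s j k \<and> sgn (v i p - v k p) = s i k"
    if "i \<in> R" "j \<in> R" "k \<in> R" for i j k
    by (rule predicted_realised[OF s[OF that(1,2)] s[OF that(2,3)] s[OF that(1,3)]])
  have refl: "s i i = 0" if "i \<in> R" for i using real[OF that that that] by auto
  have swap: "s j i = - s i j" if ij: "i \<in> R" "j \<in> R" for i j
  proof -
    obtain p where "sgn (v i p - v j p) = s i j" "sgn (v j p - v i p) = s j i"
      using real[OF ij ij(1)] by blast
    then show ?thesis by (metis minus_diff_eq sgn_minus)
  qed
  have vals: "s i j = -1 \<or> s i j = 0 \<or> s i j = 1" if ij: "i \<in> R" "j \<in> R" for i j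
  proof -
    obtain p where "s i j = sgn (v i p - v j p)" using real[OF ij ij(1)] by metis
    then show ?thesis by (simp add: sgn_if)
  qed
  have trans: "s i k = -1" if R: "i \<in> R" "j \<in> R" "k \<in> R"
    and neg: "s i j = -1 \<and> s j k \<le> 0 \<or> s i j \<le> 0 \<and> s j k = -1" for i j k
  proof -
    obtain p where p: "sgn (v i p - v j p) = s i j" "sgn (v j p - v k p) = s j k"
      "sgn (v i p - v k p) = s i k" using real[OF R] by blast
    have "v i p < v k p" using neg p(1,2) by (auto simp: sgn_if split: if_splits)
    then show ?thesis using p(3) by simp
  qed
  \<comment> \<open>Counting the elements predicted to be smaller turns the preorder into real
    weights: ties give equal sets, strict comparisons give strict inclusions.\<close>
  define D where "D i = {j \<in> R. s j i = -1}" for i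
  have fin: "finite (D i)" for i using assms(1) by (simp add: D_def)
  have sub: "D i \<subseteq> D j" if R: "i \<in> R" "j \<in> R" and "s i j \<le> 0" for i j
  proof
    fix k assume "k \<in> D i"
    then show "k \<in> D j" using trans[OF _ R, of k] that(3) by (simp add: D_def)
  qed
  have less: "card (D i) < card (D j)" if R: "i \<in> R" "j \<in> R" and neg: "s i j = -1" for i j
  proof (rule psubset_card_mono[OF fin])
    have "D i \<subseteq> D j" using sub[OF R] neg by simp
    moreover have "i \<in> D j" "i \<notin> D i" using R neg refl[of i] by (auto simp: D_def)
    ultimately show "D i \<subset> D j" by blast
  qed
  have eq: "D i = D j" if R: "i \<in> R" "j \<in> R" and "s i j = 0" for i j
    using sub[OF R] sub[OF R(2,1)] swap[OF R] that(3) by simp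
  have "sgn (real (card (D i)) - real (card (D j))) = s i j" if R: "i \<in> R" "j \<in> R" for i j
    using vals[OF R] less[OF R] less[OF R(2,1)] eq[OF R] swap[OF R] by auto
  then show ?thesis using s by (intro exI[of _ "\<lambda>i. real (card (D i))"]) simp
qed

lemma sgn_sub_via:
  fixes a b c :: real
  assumes "sgn (b - c) = s" "sgn (a - b) = s \<or> sgn (a - b) = 0"
  shows "sgn (a - c) = s"
  using assms by (auto simp: sgn_if split: if_splits)

lemma sgn_sub_if_closer:
  fixes a b c :: real
  assumes "\<bar>b - c\<bar> \<le> \<bar>a - c\<bar>" "sgn (b - c) = sgn (a - c)"
  shows "sgn (a - b) = sgn (a - c) \<or> sgn (a - b) = 0"
  using assms by (auto simp: sgn_if abs_if split: if_splits)

section \<open>Certificates for the position of a pivot\<close>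

text \<open>A certificate: the few comparisons in \<open>L\<close>, once confirmed, imply all
  comparisons of \<open>A\<close> with the pivot \<open>c\<close>. The weights \<open>w\<close>
  stand for the predicted preorder.\<close>

definition locates ::
  "('p \<Rightarrow> real) list \<Rightarrow> 'p set \<Rightarrow> 'i set \<Rightarrow> ('i \<Rightarrow> 'p \<Rightarrow> real) \<Rightarrow> ('i \<Rightarrow> real) \<Rightarrow> 'i \<Rightarrow> 'i set \<Rightarrow>
    (('p \<Rightarrow> real) \<times> real) list \<Rightarrow> bool" where
  "locates fs X R v w c A L \<longleftrightarrow>
    (\<forall>(f, s)\<in>set L. f \<in> (\<lambda>i p. v i p - v c p) ` R \<and> predicted fs X f s) \<and>
    (\<forall>p\<in>X. (\<forall>(f, s)\<in>set L. sgn (f p) = s) \<longrightarrow> (\<forall>i\<in>A. sgn (v i p - v c p) = sgn (w i - w c)))"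

lemma locates_empty: "locates fs X R v w c {} []"
  by (simp add: locates_def)

lemma locates_append:
  assumes "locates fs X R v w c A L" "locates fs X R v w c B M"
  shows "locates fs X R v w c (A \<union> B) (L @ M)"
  using assms unfolding locates_def set_append ball_Un by blast

text \<open>Given the sorted block, comparing only its predicted neighbours of the pivot already
  locates the pivot in it.\<close>

lemma locate_side:
  fixes w :: "'i \<Rightarrow> real"
  assumes w: "\<And>i j. i \<in> R \<Longrightarrow> j \<in> R \<Longrightarrow> predicted fs X (\<lambda>p. v i p - v j p) (sgn (w i - w j))"
    and B: "finite B" "B \<subseteq> R" "c \<in> R"
    and const: "\<And>i j. i \<in> B \<Longrightarrow> j \<in> B \<Longrightarrow> sign_constant X (\<lambda>p. v i p - v j p)"
  shows "\<exists>L. length L \<le> 1 \<and> locates fs X R v w c {i \<in> B. sgn (w i - w c) = \<sigma>} L"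
proof (cases "{i \<in> B. sgn (w i - w c) = \<sigma>} = {}")
  case True
  show ?thesis unfolding True by (intro exI[of _ "[]"]) (simp add: locates_empty)
next
  case False
  let ?S = "{i \<in> B. sgn (w i - w c) = \<sigma>}"
  have "finite ?S" using B(1) by simp
  \<comment> \<open>The element nearest to the pivot on side \<open>\<sigma>\<close>: the others on
    that side lie beyond it or tie with it. For \<open>\<sigma> = 0\<close> the whole side ties with
    the pivot.\<close>
  then obtain b where b: "b \<in> ?S" "\<And>i. i \<in> ?S \<Longrightarrow> \<bar>w b - w c\<bar> \<le> \<bar>w i - w c\<bar>"
    using ex_is_arg_min_if_finite[OF _ False, of "\<lambda>i. \<bar>w i - w c\<bar>"]
    unfolding is_arg_min_linorder by blast
  have bR: "b \<in> R" using b(1) B(2) by blast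
  \<comment> \<open>The sign is constant on \<open>X\<close>, and the prediction holds at some point
    of \<open>X\<close>, so the constant is the predicted sign.\<close>
  have const': "sgn (v i p - v b p) = sgn (w i - w b)" if i: "i \<in> B" and p: "p \<in> X" for i p
  proof -
    have iR: "i \<in> R" using i B(2) by blast
    obtain q where q: "q \<in> X" "sgn (v i q - v b q) = sgn (w i - w b)"
      using predicted_realised[OF w[OF iR bR] w[OF iR bR] w[OF iR bR]] by blast
    have "b \<in> B" using b(1) by blast
    then obtain s where "\<And>p. p \<in> X \<Longrightarrow> sgn (v i p - v b p) = s"
      using const[OF i] unfolding sign_constant_def by blast
    from this[OF p] this[OF q(1)] q(2) show ?thesis by simp
  qed
  have loc: "sgn (v i p - v c p) = sgn (w i - w c)"
    if "p \<in> X" "sgn (v b p - v c p) = \<sigma>" "i \<in> ?S" for p i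
  proof -
    have "sgn (w i - w b) = \<sigma> \<or> sgn (w i - w b) = 0"
      using sgn_sub_if_closer[OF b(2)[OF that(3)]] that(3) b(1) by auto
    then have "sgn (v i p - v b p) = \<sigma> \<or> sgn (v i p - v b p) = 0"
      using const'[OF _ that(1), of i] that(3) by simp
    then show ?thesis using sgn_sub_via[OF that(2)] that(3) by simp
  qed
  have pred: "predicted fs X (\<lambda>p. v b p - v c p) \<sigma>"
    using w[OF bR B(3)] b(1) by simp
  let ?L = "[(\<lambda>p. v b p - v c p, \<sigma>)]"
  have "locates fs X R v w c ?S ?L"
    unfolding locates_def
  proof (rule conjI)
    show "\<forall>(f, s)\<in>set ?L. f \<in> (\<lambda>i p. v i p - v c p) ` R \<and> predicted fs X f s"
      using pred bR by simp
    show "\<forall>p\<in>X. (\<forall>(f, s)\<in>set ?L. sgn (f p) = s) \<longrightarrow>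
        (\<forall>i\<in>?S. sgn (v i p - v c p) = sgn (w i - w c))"
    proof (intro ballI impI)
      fix p i assume p: "p \<in> X" "\<forall>(f, s)\<in>set ?L. sgn (f p) = s" and i: "i \<in> ?S"
      from p(2) have "sgn (v b p - v c p) = \<sigma>" by simp
      then show "sgn (v i p - v c p) = sgn (w i - w c)" by (rule loc[OF p(1) _ i])
    qed
  qed
  then show ?thesis by (intro exI[of _ ?L]) simp
qed

text \<open>One query each for the nearest element below the pivot, a tied element, and the nearest
  element above.\<close>

lemma locate_block:
  fixes w :: "'i \<Rightarrow> real"
  assumes "\<And>i j. i \<in> R \<Longrightarrow> j \<in> R \<Longrightarrow> predicted fs X (\<lambda>p. v i p - v j p) (sgn (w i - w j))"
    and "finite B" "B \<subseteq> R" "c \<in> R"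
    and "\<And>i j. i \<in> B \<Longrightarrow> j \<in> B \<Longrightarrow> sign_constant X (\<lambda>p. v i p - v j p)"
  shows "\<exists>L. length L \<le> 3 \<and> locates fs X R v w c B L"
proof -
  let ?S = "\<lambda>\<sigma>. {i \<in> B. sgn (w i - w c) = \<sigma>}"
  have side: "\<exists>L. length L \<le> 1 \<and> locates fs X R v w c (?S \<sigma>) L" for \<sigma>
    by (rule locate_side[OF assms])
  obtain L where L: "length L \<le> 1" "locates fs X R v w c (?S (-1)) L" using side by blast
  obtain M where M: "length M \<le> 1" "locates fs X R v w c (?S 0) M" using side by blast
  obtain N where N: "length N \<le> 1" "locates fs X R v w c (?S 1) N" using side by blast
  have "?S (-1) \<union> (?S 0 \<union> ?S 1) = B" by (auto simp: sgn_if)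
  with locates_append[OF L(2) locates_append[OF M(2) N(2)]]
  have "locates fs X R v w c B (L @ M @ N)" by (simp only:)
  then show ?thesis using L(1) M(1) N(1) by (intro exI[of _ "L @ M @ N"]) simp
qed

text \<open>Each block is ordered internally and certified against the same pivot; the certificates
  are concatenated.\<close>

lemma locate_blocks:
  fixes w :: "'i \<Rightarrow> real"
  assumes w: "\<And>i j. i \<in> R \<Longrightarrow> j \<in> R \<Longrightarrow> predicted fs X (\<lambda>p. v i p - v j p) (sgn (w i - w j))"
    and c: "c \<in> R"
    and "\<And>B. B \<in> set Bs \<Longrightarrow> finite B \<and> B \<subseteq> R"
    and "\<And>B i j. B \<in> set Bs \<Longrightarrow> i \<in> B \<Longrightarrow> j \<in> B \<Longrightarrow> sign_constant X (\<lambda>p. v i p - v j p)"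
  shows "\<exists>L. length L \<le> 3 * length Bs \<and> locates fs X R v w c (\<Union>(set Bs)) L"
  using assms(3,4)
proof (induction Bs)
  case Nil
  show ?case by (intro exI[of _ "[]"]) (simp add: locates_empty)
next
  case (Cons B Bs)
  have "\<exists>L. length L \<le> 3 * length Bs \<and> locates fs X R v w c (\<Union>(set Bs)) L"
  proof (rule Cons.IH)
    fix B' assume "B' \<in> set Bs"
    then show "finite B' \<and> B' \<subseteq> R" by (intro Cons.prems(1)) simp
  next
    fix B' i j assume "B' \<in> set Bs" "i \<in> B'" "j \<in> B'"
    then show "sign_constant X (\<lambda>p. v i p - v j p)" by (intro Cons.prems(2)[of B' i j]) simp_all
  qed
  then obtain L where L: "length L \<le> 3 * length Bs" "locates fs X R v w c (\<Union>(set Bs)) L" by blast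
  have "\<exists>L. length L \<le> 3 \<and> locates fs X R v w c B L"
  proof (rule locate_block[OF w _ _ c])
    show "finite B" "B \<subseteq> R" using Cons.prems(1)[of B] by simp_all
    fix i j assume "i \<in> B" "j \<in> B"
    then show "sign_constant X (\<lambda>p. v i p - v j p)" by (intro Cons.prems(2)[of B i j]) simp_all
  qed
  then obtain M where M: "length M \<le> 3" "locates fs X R v w c B M" by blast
  show ?case
    using locates_append[OF M(2) L(2)] M(1) L(1) by (intro exI[of _ "M @ L"]) simp
qed

section \<open>Sorting and selection\<close>

text \<open>Insertion sort: task \<open>\<tau>\<close> inserts item \<open>\<tau>\<close> into the
  sorted earlier items, taken as a single block, so \<open>c = 3\<close> replaces a binary
  search.\<close>

lemma dec_sort:
  fixes v :: "nat \<Rightarrow> 'p \<Rightarrow> real"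
  assumes fs: "set fs \<subseteq> F" "\<And>i j. i < N \<Longrightarrow> j < N \<Longrightarrow> (\<lambda>p. v i p - v j p) \<in> set fs"
    and g: "card (sig fs ` X) * 2 ^ g \<le> 3 ^ g"
  shows "dec F (\<lambda>Y. \<forall>i<N. \<forall>j<N. sign_constant Y (\<lambda>p. v i p - v j p)) (3 * (N + g)) X"
proof -
  define P where "P \<tau> Y \<longleftrightarrow> (\<forall>i\<le>\<tau>. \<forall>j\<le>\<tau>. sign_constant Y (\<lambda>p. v i p - v j p))" for \<tau> Y
  have "dec F (\<lambda>Y. \<forall>\<sigma><N. P \<sigma> Y) (3 * (N - 0 + g)) X"
  proof (rule predicted_amortised[OF fs(1), where P = P and Z = UNIV])
    fix Y and \<tau> :: nat
    assume \<tau>: "\<tau> < N" "\<forall>\<sigma><\<tau>. P \<sigma> Y" and pre: "\<forall>f\<in>set fs. \<exists>s. predicted fs Y f s"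
    have "\<exists>w :: nat \<Rightarrow> real. \<forall>i\<in>{..\<tau>}. \<forall>j\<in>{..\<tau>}. predicted fs Y (\<lambda>p. v i p - v j p) (sgn (w i - w j))"
      by (rule predicted_order) (use pre fs(2) \<tau>(1) in auto)
    then obtain w :: "nat \<Rightarrow> real" where
      w: "\<And>i j. i \<in> {..\<tau>} \<Longrightarrow> j \<in> {..\<tau>} \<Longrightarrow> predicted fs Y (\<lambda>p. v i p - v j p) (sgn (w i - w j))"
      by blast
    \<comment> \<open>The order of items \<open>i\<close> and \<open>j\<close> was settled by task
      \<open>max i j\<close>.\<close>
    have old: "sign_constant Y (\<lambda>p. v i p - v j p)" if "i < \<tau>" "j < \<tau>" for i j
      using \<tau>(2)[rule_format, of "max i j"] that unfolding P_def by auto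
    have "\<exists>L. length L \<le> 3 \<and> locates fs Y {..\<tau>} v w \<tau> {..<\<tau>} L"
      by (rule locate_block[OF w]) (use old in auto)
    then obtain L where L: "length L \<le> 3"
      "\<forall>(f, s)\<in>set L. f \<in> (\<lambda>i p. v i p - v \<tau> p) ` {..\<tau>} \<and> predicted fs Y f s"
      "\<forall>p\<in>Y. (\<forall>(f, s)\<in>set L. sgn (f p) = s) \<longrightarrow>
        (\<forall>i\<in>{..<\<tau>}. sgn (v i p - v \<tau> p) = sgn (w i - w \<tau>))" unfolding locates_def by blast
    let ?Z = "{p \<in> Y. \<forall>(f, s)\<in>set L. sgn (f p) = s}"
    have new: "sign_constant ?Z (\<lambda>p. v i p - v \<tau> p)" if "i < \<tau>" for i
      unfolding sign_constant_def using L(3) that by (intro exI[of _ "sgn (w i - w \<tau>)"]) blast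
    have "sign_constant ?Z (\<lambda>p. v i p - v j p)" if ij: "i \<le> \<tau>" "j \<le> \<tau>" for i j
    proof -
      consider "i < \<tau>" "j < \<tau>" | "i < \<tau>" "j = \<tau>" | "i = \<tau>" "j < \<tau>" | "i = \<tau>" "j = \<tau>"
        using ij by linarith
      then show ?thesis
      proof cases
        case 1 then show ?thesis by (rule sign_constant_subset[OF old]) blast
      next
        case 2 then show ?thesis using new by simp
      next
        case 3 then show ?thesis using sign_constant_swap[OF new] by simp
      next
        case 4 then show ?thesis by (simp add: sign_constant_def)
      qed
    qed
    then have "P \<tau> ?Z" by (simp add: P_def)
    moreover have "\<forall>(f, s)\<in>set L. f \<in> set fs \<and> predicted fs Y f s"
      using L(2) fs(2) \<tau>(1) by fastforce
    ultimately show "\<exists>L. length L \<le> 3 \<and> (\<forall>(f, s)\<in>set L. f \<in> set fs \<and> predicted fs Y f s) \<and>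
          P \<tau> {p \<in> Y. \<forall>(f, s)\<in>set L. sgn (f p) = s}"
      using L(1) by blast
  qed (use g in \<open>auto simp: P_def intro: sign_constant_subset\<close>)
  moreover have "\<forall>i<N. \<forall>j<N. sign_constant Y (\<lambda>p. v i p - v j p)" if Y: "\<forall>\<sigma><N. P \<sigma> Y" for Y
  proof (intro allI impI)
    fix i j assume "i < N" "j < N"
    then show "sign_constant Y (\<lambda>p. v i p - v j p)"
      using Y[rule_format, of "max i j"] by (simp add: P_def)
  qed
  ultimately have "dec F (\<lambda>Y. \<forall>i<N. \<forall>j<N. sign_constant Y (\<lambda>p. v i p - v j p)) (3 * (N - 0 + g) + 0) X"
    by (rule dec_bind[OF _ dec_stop])
  then show ?thesis by simp
qed

section \<open>Medians through comparison counts\<close>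

lemma median_in_set:
  assumes "xs \<noteq> []" shows "median xs \<in> set xs"
proof -
  have "(length xs - 1) div 2 < length (sort xs)" using assms by (cases xs) auto
  then have "median xs \<in> set (sort xs)" unfolding median_def by (rule nth_mem)
  then show ?thesis by simp
qed

text \<open>This criterion sees the entries only through comparisons with \<open>m\<close>. For
  uniqueness, if \<open>a < b\<close> then the entries up to \<open>a\<close> are among those below
  \<open>b\<close>, so \<open>a\<close> and \<open>b\<close> cannot both pass.\<close>

lemma median_eq_iff:
  assumes "xs \<noteq> []"
  defines "h \<equiv> (length xs - 1) div 2"
  shows "median xs = m \<longleftrightarrow> length (filter (\<lambda>x. x < m) xs) \<le> h \<and> h < length (filter (\<lambda>x. x \<le> m) xs)"
proof -
  let ?ok = "\<lambda>m. length (filter (\<lambda>x. x < m) xs) \<le> h \<and> h < length (filter (\<lambda>x. x \<le> m) xs)"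
  let ?ys = "sort xs"
  have len: "length (filter P xs) = card {i. i < length xs \<and> P (?ys ! i)}" for P
    using length_filter_conv_card[of P ?ys] by (simp add: filter_sort)
  have h: "h < length xs"
    using assms by (cases xs) (auto simp: h_def)
  have mono: "?ys ! i \<le> ?ys ! j" if "i \<le> j" "j < length xs" for i j
    using that by (intro sorted_nth_mono) auto
  have "{i. i < length xs \<and> ?ys ! i < ?ys ! h} \<subseteq> {..<h}"
    using mono[of h] by (force simp flip: not_le)
  then have 1: "length (filter (\<lambda>x. x < ?ys ! h) xs) \<le> h"
    unfolding len by (metis card_lessThan card_mono finite_lessThan)
  have "{..h} \<subseteq> {i. i < length xs \<and> ?ys ! i \<le> ?ys ! h}"
    using mono[of _ h] h by auto
  then have "card {..h} \<le> card {i. i < length xs \<and> ?ys ! i \<le> ?ys ! h}"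
    by (intro card_mono) auto
  then have 2: "h < length (filter (\<lambda>x. x \<le> ?ys ! h) xs)"
    unfolding len by simp
  have ok: "?ok (median xs)" using 1 2 by (simp add: median_def h_def)
  have le: "length (filter (\<lambda>x. x \<le> a) xs) \<le> length (filter (\<lambda>x. x < b) xs)" if "a < b" for a b
    unfolding len using that by (intro card_mono) auto
  have "a = b" if "?ok a" "?ok b" for a b
    using le[of a b] le[of b a] that by linarith
  then show ?thesis using ok by metis
qed

lemma median_transfer:
  fixes v w :: "'i \<Rightarrow> real"
  assumes "is \<noteq> []" "\<And>i. i \<in> set is \<Longrightarrow> sgn (v i - v c) = sgn (w i - w c)"
    and "median (map w is) = w c"
  shows "median (map v is) = v c"
proof -
  have lt: "(v i < v c) = (w i < w c)" "(v i \<le> v c) = (w i \<le> w c)" if "i \<in> set is" for i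
    using assms(2)[OF that] by (auto simp: sgn_if split: if_splits)
  have "filter (\<lambda>i. v i < v c) is = filter (\<lambda>i. w i < w c) is"
    "filter (\<lambda>i. v i \<le> v c) is = filter (\<lambda>i. w i \<le> w c) is"
    by (intro filter_cong refl lt; assumption)+
  then have len: "length (filter (\<lambda>x. x < v c) (map v is)) = length (filter (\<lambda>x. x < w c) (map w is))"
    "length (filter (\<lambda>x. x \<le> v c) (map v is)) = length (filter (\<lambda>x. x \<le> w c) (map w is))"
    by (simp_all add: filter_map o_def)
  have ne: "map v is \<noteq> []" "map w is \<noteq> []" using assms(1) by simp_all
  show ?thesis
    using assms(3) unfolding median_eq_iff[OF ne(1)] median_eq_iff[OF ne(2)] len length_map .
qed

text \<open>Task \<open>k\<close> is row \<open>k\<close>; locating its predicted median takes three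
  queries per block, hence \<open>c = 3 * r\<close>. The index \<open>i\<close> is chosen before the
  point \<open>p\<close> because a leaf names one linear form for all its inputs.\<close>

lemma dec_median:
  fixes v :: "nat \<Rightarrow> nat \<Rightarrow> 'p \<Rightarrow> real"
  assumes fs: "set fs \<subseteq> F"
      "\<And>k i j. k < n \<Longrightarrow> i \<le> k \<Longrightarrow> j \<le> k \<Longrightarrow> (\<lambda>p. v k i p - v k j p) \<in> set fs"
    and r: "r \<ge> 1"
    and Bs: "\<And>k. k < n \<Longrightarrow> length (Bs k) \<le> r \<and> \<Union>(set (Bs k)) = {..k}"
    and const: "\<And>k B i j. k < n \<Longrightarrow> B \<in> set (Bs k) \<Longrightarrow> i \<in> B \<Longrightarrow> j \<in> B \<Longrightarrow>
      sign_constant X (\<lambda>p. v k i p - v k j p)"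
    and g: "card (sig fs ` X) * 2 ^ g \<le> 3 ^ g"
  shows "dec F (\<lambda>Y. \<forall>k<n. \<exists>i\<le>k. \<forall>p\<in>Y. median (map (\<lambda>i. v k i p) [0..<Suc k]) = v k i p)
    (3 * r * (n + g)) X"
proof -
  let ?P = "\<lambda>k Y. \<exists>i\<le>k. \<forall>p\<in>Y. median (map (\<lambda>i. v k i p) [0..<Suc k]) = v k i p"
  have "dec F (\<lambda>Y. \<forall>k<n. ?P k Y) (3 * r * (n - 0 + g)) X"
  proof (rule predicted_amortised[OF fs(1), where P = ?P and Z = X])
    fix Y and k :: nat
    assume k: "k < n" and Y: "Y \<subseteq> X" and pre: "\<forall>f\<in>set fs. \<exists>s. predicted fs Y f s"
    have "\<exists>w :: nat \<Rightarrow> real. \<forall>i\<in>{..k}. \<forall>j\<in>{..k}. predicted fs Y (\<lambda>p. v k i p - v k j p) (sgn (w i - w j))"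
      by (rule predicted_order) (use pre fs(2) k in auto)
    then obtain w :: "nat \<Rightarrow> real" where
      w: "\<And>i j. i \<in> {..k} \<Longrightarrow> j \<in> {..k} \<Longrightarrow> predicted fs Y (\<lambda>p. v k i p - v k j p) (sgn (w i - w j))"
      by blast
    have "median (map w [0..<Suc k]) \<in> set (map w [0..<Suc k])" by (rule median_in_set) simp
    \<comment> \<open>The candidate is the median of the predicted weights, hence the same for all
      inputs in \<open>Y\<close> and known before the task makes any query.\<close>
    then obtain c where c: "c \<le> k" "median (map w [0..<Suc k]) = w c" by (auto simp: less_Suc_eq_le simp del: upt_Suc)
    have "\<exists>L. length L \<le> 3 * length (Bs k) \<and> locates fs Y {..k} (v k) w c (\<Union>(set (Bs k))) L"
    proof (rule locate_blocks[OF w])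
      show "c \<in> {..k}" using c(1) by simp
      show "finite B \<and> B \<subseteq> {..k}" if "B \<in> set (Bs k)" for B
      proof -
        have "B \<subseteq> {..k}" using Bs[OF k] that by blast
        then show ?thesis using finite_subset by blast
      qed
      show "sign_constant Y (\<lambda>p. v k i p - v k j p)" if "B \<in> set (Bs k)" "i \<in> B" "j \<in> B" for B i j
        by (rule sign_constant_subset[OF const[OF k that] Y])
    qed
    moreover have "\<Union>(set (Bs k)) = {..k}" using Bs[OF k] by blast
    ultimately have "\<exists>L. length L \<le> 3 * length (Bs k) \<and> locates fs Y {..k} (v k) w c {..k} L"
      by (simp only:)
    then obtain L where L: "length L \<le> 3 * length (Bs k)"
      "\<forall>(f, s)\<in>set L. f \<in> (\<lambda>i p. v k i p - v k c p) ` {..k} \<and> predicted fs Y f s"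
      "\<forall>p\<in>Y. (\<forall>(f, s)\<in>set L. sgn (f p) = s) \<longrightarrow>
        (\<forall>i\<in>{..k}. sgn (v k i p - v k c p) = sgn (w i - w c))"
      unfolding locates_def by blast
    have "median (map (\<lambda>i. v k i p) [0..<Suc k]) = v k c p"
      if p: "p \<in> {p \<in> Y. \<forall>(f, s)\<in>set L. sgn (f p) = s}" for p
    proof (rule median_transfer[OF _ _ c(2)])
      fix i assume "i \<in> set [0..<Suc k]"
      then have "i \<in> {..k}" by (simp only: set_upt atLeastLessThan_iff atMost_iff less_Suc_eq_le)
      then show "sgn (v k i p - v k c p) = sgn (w i - w c)" using L(3) p by blast
    qed simp
    then have "?P k {p \<in> Y. \<forall>(f, s)\<in>set L. sgn (f p) = s}" using c(1) by blast
    moreover have "\<forall>(f, s)\<in>set L. f \<in> set fs \<and> predicted fs Y f s"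
      using L(2) fs(2) k c(1) by fastforce
    moreover have "length L \<le> 3 * r" using L(1) Bs[OF k] by linarith
    ultimately show "\<exists>L. length L \<le> 3 * r \<and> (\<forall>(f, s)\<in>set L. f \<in> set fs \<and> predicted fs Y f s) \<and>
          ?P k {p \<in> Y. \<forall>(f, s)\<in>set L. sgn (f p) = s}"
      by blast
  next
    show "?P k Z" if "?P k Y" "Z \<subseteq> Y" for k Y Z using that by blast
  qed (use g r in auto)
  then show ?thesis by simp
qed

section \<open>The convolution\<close>

lemma div_eq_imp_diff_less:
  fixes i j d :: nat
  assumes "i div d = j div d" "i \<le> j" "d > 0"
  shows "j - i < d"
proof -
  have "j < d * (i div d) + d" using assms(1,3) by (metis dividend_less_times_div mult.commute add.commute)
  moreover have "d * (i div d) \<le> i" by simp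
  ultimately show ?thesis using assms(2) by linarith
qed

text \<open>Within a row, \<open>(x j - y (k - j)) - (x i - y (k - i))\<close> is the difference of
  \<open>x j - x i\<close> and \<open>y (k - j) - y (k - i)\<close> (Fredman's trick), so the sorted list of the
  short-range differences of \<open>x\<close> and of \<open>y\<close> determines the order of every block of every row.\<close>

lemma median_minus_conv_ldt:
  fixes n d l :: nat
  assumes n: "n \<ge> 1" "n \<le> 2 ^ l" and d: "d \<ge> 1" "d \<le> n"
  defines "g \<equiv> 16 * n * (l + 1)"
  shows "\<exists>T. ldt_computes n T (median_minus_conv n) \<and>
    ldt_depth T \<le> 3 * (2 * n * d + g) + 3 * (n div d + 1) * (n + g)"
proof -
  define pairs where "pairs = filter (\<lambda>(i, e). i + e < n) (List.product [0..<n] [0..<d])"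
  define A where "A = (\<lambda>(i, e) (p :: (nat \<Rightarrow> real) \<times> (nat \<Rightarrow> real)). fst p (i + e) - fst p i)"
  \<comment> \<open>With this orientation \<open>A (i, j - i) - B (k - j, j - i)\<close> is
    \<open>v k j - v k i\<close>, so sorting the items compares entries within rows.\<close>
  define B where "B = (\<lambda>(i, e) (p :: (nat \<Rightarrow> real) \<times> (nat \<Rightarrow> real)). snd p i - snd p (i + e))"
  define its where "its = map A pairs @ map B pairs"
  define v where "v k i = (\<lambda>p :: (nat \<Rightarrow> real) \<times> (nat \<Rightarrow> real). fst p i - snd p (k - i))" for k i :: nat
  define rows where "rows = filter (\<lambda>(k, i, j). i \<le> k \<and> j \<le> k)
    (List.product [0..<n] (List.product [0..<n] [0..<n]))"
  \<comment> \<open>One list holds the comparisons of both phases, so the same bound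
    \<open>g\<close> serves both.\<close>
  define fs where "fs = map (\<lambda>(a, b) p. a p - b p) (List.product its its) @
    map (\<lambda>(k, i, j) p. v k i p - v k j p) rows"
  define r where "r = n div d + 1"
  let ?F = "linear_queries n"

  have v_lin: "v k i \<in> ?F" if "k < n" "i \<le> k" for k i
    unfolding v_def using that
    by (intro linear_queries_diff linear_queries_fst linear_queries_snd) auto
  have A_lin: "A q \<in> ?F" if "q \<in> set pairs" for q
    using that unfolding A_def pairs_def
    by (auto intro!: linear_queries_diff linear_queries_fst)
  have B_lin: "B q \<in> ?F" if "q \<in> set pairs" for q
    using that unfolding B_def pairs_def
    by (auto intro!: linear_queries_diff linear_queries_snd)
  have its_lin: "a \<in> ?F" if "a \<in> set its" for a
    using that A_lin B_lin unfolding its_def by auto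
  have its_fs: "(\<lambda>p. a p - b p) \<in> set fs" if "a \<in> set its" "b \<in> set its" for a b
    using that unfolding fs_def by force
  have row_fs: "(\<lambda>p. v k i p - v k j p) \<in> set fs" if "k < n" "i \<le> k" "j \<le> k" for k i j
  proof -
    have "(k, i, j) \<in> set rows" using that by (simp add: rows_def)
    then show ?thesis unfolding fs_def by force
  qed
  have fs: "set fs \<subseteq> ?F"
  proof
    fix f assume "f \<in> set fs"
    then consider a b where "a \<in> set its" "b \<in> set its" "f = (\<lambda>p. a p - b p)"
      | k i j where "k < n" "i \<le> k" "j \<le> k" "f = (\<lambda>p. v k i p - v k j p)"
      unfolding fs_def rows_def by auto
    then show "f \<in> ?F"
      by cases (simp_all add: linear_queries_diff its_lin v_lin)
  qed

  have "length pairs \<le> n * d"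
    unfolding pairs_def using length_filter_le[of _ "List.product [0..<n] [0..<d]"]
    by (simp add: length_product)
  then have its_len: "length its \<le> 2 * n * d" by (simp add: its_def)
  have "length rows \<le> n * (n * n)"
    unfolding rows_def using length_filter_le[of _ "List.product [0..<n] (List.product [0..<n] [0..<n])"]
    by (simp add: length_product)
  moreover have "length fs = length its * length its + length rows"
    by (simp add: fs_def length_product)
  moreover have "length its \<le> 2 * n * n"
    using its_len mult_le_mono2[OF d(2), of "2 * n"] by linarith
  then have "length its * length its \<le> (2 * n * n) * (2 * n * n)"
    by (intro mult_le_mono)
  moreover have "(2 * n * n) * (2 * n * n) = 4 * n ^ 4"
    by (simp add: eval_nat_numeral algebra_simps)
  moreover have "n * (n * n) \<le> n ^ 4"
    using n(1) by (simp add: eval_nat_numeral)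
  \<comment> \<open>The pairs of at most \<open>2 * n * n\<close> items give
    \<open>4 * n ^ 4\<close>, the rows at most \<open>n ^ 4\<close>.\<close>
  ultimately have "length fs \<le> 5 * n ^ 4" by linarith
  moreover have "1 \<le> n ^ 4" using n(1) by simp
  ultimately have "2 * length fs + 1 \<le> 16 * n ^ 4" by linarith
  also have "\<dots> \<le> 2 ^ 4 * (2 ^ l) ^ 4"
    using n(2) by (intro mult_mono power_mono) auto
  also have "\<dots> = 2 ^ (4 * (l + 1))" by (simp add: power_add power_mult mult.commute flip: power_mult)
  finally have len: "2 * length fs + 1 \<le> 2 ^ (4 * (l + 1))" .
  have card_g: "card (sig fs ` X) * 2 ^ g \<le> 3 ^ g" for X
  proof -
    \<comment> \<open>The exponent is \<open>4 * (l + 1)\<close> times \<open>2 * n\<close>. Two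
      failures more than halve the number of sign vectors, so \<open>g = 2 * m\<close> suffices;
      this is \<open>8 \<le> 9\<close> below.\<close>
    define m where "m = 8 * n * (l + 1)"
    have "card (sig fs ` X) \<le> card (sig fs ` UNIV)" by (intro card_mono) auto
    also have "\<dots> \<le> (2 * length fs + 1) ^ (2 * n)" by (rule card_sig_linear[OF fs])
    also have "\<dots> \<le> (2 ^ (4 * (l + 1))) ^ (2 * n)" using len by (intro power_mono) auto
    also have "\<dots> = 2 ^ m" unfolding m_def by (subst power_mult[symmetric]) (simp add: algebra_simps)
    finally have "card (sig fs ` X) * 2 ^ g \<le> 2 ^ m * 2 ^ g" by (rule mult_right_mono) simp
    also have "g = 2 * m" by (simp add: g_def m_def)
    also have "2 ^ m * 2 ^ (2 * m) = (8::nat) ^ m"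
      by (simp add: power_mult flip: power_mult_distrib)
    also have "\<dots> \<le> 9 ^ m" by (intro power_mono) auto
    also have "\<dots> = 3 ^ (2 * m)" by (simp add: power_mult)
    finally show ?thesis using \<open>g = 2 * m\<close> by simp
  qed

  \<comment> \<open>At such a leaf the median of row \<open>k\<close> sits at one index
    \<open>i\<close>, so the output for that row is the linear form \<open>v k i\<close>.\<close>
  have final: "\<exists>outs. \<forall>(x, y)\<in>Y. median_minus_conv n x y = map (\<lambda>q. lin_val n q x y) outs"
    if Y: "\<forall>k<n. \<exists>i\<le>k. \<forall>p\<in>Y. median (map (\<lambda>i. v k i p) [0..<Suc k]) = v k i p" for Y
  proof -
    have "\<forall>k\<in>{..<n}. \<exists>q. \<forall>x y. (x, y) \<in> Y \<longrightarrow>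
        median (map (\<lambda>i. x i - y (k - i)) [0..<Suc k]) = lin_val n q x y"
    proof
      fix k assume "k \<in> {..<n}"
      then have k: "k < n" by simp
      then obtain i where i: "i \<le> k" "\<forall>p\<in>Y. median (map (\<lambda>i. v k i p) [0..<Suc k]) = v k i p"
        using Y by blast
      obtain q where q: "\<forall>x y. v k i (x, y) = lin_val n q x y"
        using v_lin[OF k i(1)] unfolding linear_queries_def by blast
      have "median (map (\<lambda>i. x i - y (k - i)) [0..<Suc k]) = lin_val n q x y" if "(x, y) \<in> Y" for x y
        using bspec[OF i(2) that] q[rule_format, of x y] by (simp only: v_def fst_conv snd_conv)
      then show "\<exists>q. \<forall>x y. (x, y) \<in> Y \<longrightarrow>
          median (map (\<lambda>i. x i - y (k - i)) [0..<Suc k]) = lin_val n q x y" by blast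
    qed
    from bchoice[OF this] obtain q where q: "\<And>k x y. k < n \<Longrightarrow> (x, y) \<in> Y \<Longrightarrow>
        median (map (\<lambda>i. x i - y (k - i)) [0..<Suc k]) = lin_val n (q k) x y" by blast
    have "median_minus_conv n x y = map (\<lambda>q. lin_val n q x y) (map q [0..<n])" if "(x, y) \<in> Y" for x y
      unfolding median_minus_conv_def map_map o_def
      by (rule map_cong[OF refl], rule q[OF _ that]) simp
    then show ?thesis by blast
  qed

  have select: "dec ?F (\<lambda>Y. \<exists>outs. \<forall>(x, y)\<in>Y. median_minus_conv n x y = map (\<lambda>q. lin_val n q x y) outs)
      (3 * r * (n + g) + 0) Y"
    if Y: "\<forall>i<length its. \<forall>j<length its. sign_constant Y (\<lambda>p. (its ! i) p - (its ! j) p)" for Y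
  proof -
    have its_const: "sign_constant Y (\<lambda>p. a p - b p)" if ab: "a \<in> set its" "b \<in> set its" for a b
    proof -
      obtain i j where "i < length its" "j < length its" "a = its ! i" "b = its ! j"
        using ab unfolding in_set_conv_nth by blast
      then show ?thesis using Y by blast
    qed
    \<comment> \<open>Indices in one block differ by less than \<open>d\<close>, so both differences
      of Fredman's trick are among the sorted items.\<close>
    have ordered: "sign_constant Y (\<lambda>p. v k j p - v k i p)"
      if k: "k < n" and ij: "i \<le> j" "j \<le> k" and same: "i div d = j div d" for k i j
    proof -
      have e: "j - i < d" using div_eq_imp_diff_less[OF same ij(1)] d(1) by simp
      have "(i, j - i) \<in> set pairs" "(k - j, j - i) \<in> set pairs"
        using k ij e by (auto simp: pairs_def)
      then have "A (i, j - i) \<in> set its" "B (k - j, j - i) \<in> set its"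
        by (auto simp: its_def)
      then have "sign_constant Y (\<lambda>p. A (i, j - i) p - B (k - j, j - i) p)" by (rule its_const)
      moreover have "(\<lambda>p. A (i, j - i) p - B (k - j, j - i) p) = (\<lambda>p. v k j p - v k i p)"
        using ij by (auto simp: A_def B_def v_def)
      ultimately show ?thesis by simp
    qed
    \<comment> \<open>Index intervals of length \<open>d\<close>, cut off at \<open>k\<close>. The
      extra one in \<open>r\<close> covers a last incomplete interval; blocks beyond
      \<open>k\<close> are empty.\<close>
    let ?Bs = "\<lambda>k. map (\<lambda>b. {i. i \<le> k \<and> i div d = b}) [0..<r]"
    have "dec ?F (\<lambda>Y. \<forall>k<n. \<exists>i\<le>k. \<forall>p\<in>Y. median (map (\<lambda>i. v k i p) [0..<Suc k]) = v k i p)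
        (3 * r * (n + g)) Y"
    proof (rule dec_median[OF fs row_fs _ _ _ card_g, where Bs = ?Bs])
      show "1 \<le> r" by (simp add: r_def)
      show "length (?Bs k) \<le> r \<and> \<Union>(set (?Bs k)) = {..k}" if "k < n" for k
      proof -
        have "i div d < r" if "i \<le> k" for i
          using div_le_mono[of i n d] that \<open>k < n\<close> by (simp add: r_def)
        then show ?thesis by auto
      qed
      show "sign_constant Y (\<lambda>p. v k i p - v k j p)"
        if "k < n" "C \<in> set (?Bs k)" "i \<in> C" "j \<in> C" for k C i j
      proof (cases "i \<le> j")
        case True
        then show ?thesis using that by (intro sign_constant_swap[OF ordered]) auto
      next
        case False
        then show ?thesis using that by (intro ordered) auto
      qed
    qed
    then show ?thesis by (rule dec_bind) (rule dec_stop, rule final)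
  qed

  have "dec ?F (\<lambda>Y. \<forall>i<length its. \<forall>j<length its. sign_constant Y (\<lambda>p. (its ! i) p - (its ! j) p))
      (3 * (length its + g)) UNIV"
    by (rule dec_sort[OF fs _ card_g]) (simp add: its_fs)
  from dec_imp_ldt[OF dec_bind[OF this select]]
  obtain T where T: "ldt_depth T \<le> 3 * (length its + g) + (3 * r * (n + g) + 0)"
    "\<forall>(x, y)\<in>UNIV. ldt_eval n T x y = median_minus_conv n x y" by blast
  have "3 * (length its + g) \<le> 3 * (2 * n * d + g)"
    using its_len by (intro mult_le_mono2 add_le_mono1)
  then have "ldt_depth T \<le> 3 * (2 * n * d + g) + 3 * (n div d + 1) * (n + g)"
    using T(1) unfolding r_def by linarith
  then show ?thesis using T(2) unfolding ldt_computes_def by auto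
qed

section \<open>Balancing the two phases\<close>

theorem theorem12:
  shows "\<exists>c>0. \<forall>\<^sub>F n in sequentially. \<exists>T.
           ldt_computes n T (median_minus_conv n) \<and>
           real (ldt_depth T) \<le> c * real n * sqrt (real n * log 2 (real n))"
proof (intro exI[of _ 450] conjI)
  show "\<forall>\<^sub>F n in sequentially. \<exists>T. ldt_computes n T (median_minus_conv n) \<and>
      real (ldt_depth T) \<le> 450 * real n * sqrt (real n * log 2 (real n))"
  proof (rule eventually_sequentiallyI[of 2])
    fix n :: nat assume n: "n \<ge> 2"
    define L where "L = log 2 (real n)"
    define s where "s = sqrt (real n * L)"
    \<comment> \<open>Sorting costs about \<open>n * d\<close> and selection about
      \<open>(n / d) * n * L\<close>; these agree at \<open>d = s\<close>. Rounding up at most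
      doubles it, since \<open>s \<ge> 1\<close>.\<close>
    define d where "d = nat \<lceil>s\<rceil>"
    define l where "l = nat \<lceil>L\<rceil>"
    define g where "g = 16 * n * (l + 1)"
    have L1: "L \<ge> 1" using n by (simp add: L_def le_log_iff)
    have "real n \<le> 2 ^ n" by (simp add: of_nat_less_two_power less_imp_le)
    then have Ln: "L \<le> real n" using n by (simp add: L_def log_le_iff powr_realpow)
    have s2: "s * s = real n * L" using L1 by (simp add: s_def)
    have "real n * L \<ge> 1 * 1" using n L1 by (intro mult_mono) auto
    then have s1: "s \<ge> 1" by (simp add: s_def)
    have "s \<le> sqrt (real n * real n)" unfolding s_def using Ln by (intro real_sqrt_le_mono mult_left_mono) auto
    then have sn: "s \<le> real n" by simp
    have "sqrt (L * L) \<le> s" unfolding s_def using Ln L1 by (intro real_sqrt_le_mono mult_right_mono) auto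
    then have Ls: "L \<le> s" using L1 by simp
    have ds: "s \<le> real d" "real d \<le> 2 * s" using s1 by (simp_all add: d_def) linarith+
    have d: "d \<ge> 1" "d \<le> n" using ds(1) s1 sn by (simp, simp add: d_def nat_le_iff ceiling_le_iff)
    have "real n = 2 powr L" using n by (simp add: L_def)
    also have "\<dots> \<le> 2 powr real l" unfolding l_def using L1 by (intro powr_mono) auto
    also have "\<dots> = 2 ^ l" by (simp add: powr_realpow)
    finally have "real n \<le> real (2 ^ l)" by simp
    then have nl: "n \<le> 2 ^ l" by (simp only: of_nat_le_iff)
    \<comment> \<open>Here \<open>l \<le> L + 1\<close> and \<open>L \<ge> 1\<close>; the factor 3
      turns 16 into the 48 below.\<close>
    have "real l + 1 \<le> 3 * L" using L1 unfolding l_def by linarith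
    then have "16 * real n * (real l + 1) \<le> 16 * real n * (3 * L)" by (intro mult_left_mono) auto
    moreover have "real g = 16 * real n * (real l + 1)" by (simp add: g_def algebra_simps)
    ultimately have g: "real g \<le> 48 * (real n * L)" by linarith
    have nL: "real n * L \<le> real n * s" using Ls by (intro mult_left_mono) auto
    have "real (n div d) \<le> real n / real d" by (rule of_nat_div_le_of_nat)
    also have "\<dots> \<le> real n / s" using ds(1) s1 by (intro divide_left_mono) auto
    finally have "real (n div d) \<le> real n / s" .
    moreover have "1 \<le> real n / s" using sn s1 by simp
    \<comment> \<open>Since \<open>s \<le> n\<close>, the rounding term 1 is also at most
      \<open>n / s\<close>. This doubling and 49 = 48 + 1, from \<open>n \<le> n * L\<close>, lead
      to 98.\<close>
    ultimately have "real (n div d + 1) \<le> real n / s + real n / s" by simp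
    moreover have "real (n + g) \<le> 49 * (s * s)"
      using g mult_left_mono[OF L1, of "real n"] unfolding s2 by simp
    ultimately have "real (n div d + 1) * real (n + g) \<le> (real n / s + real n / s) * (49 * (s * s))"
      by (intro mult_mono) (use s1 in auto)
    also have "\<dots> = 98 * (real n * s)" using s1 by (simp add: field_simps)
    finally have rg: "real (n div d + 1) * real (n + g) \<le> 98 * (real n * s)" .
    have nd: "real n * real d \<le> 2 * (real n * s)"
      using mult_left_mono[OF ds(2), of "real n"] by simp
    have "1 \<le> n" using n by simp
    from median_minus_conv_ldt[OF this nl d] obtain T where
      T: "ldt_computes n T (median_minus_conv n)"
      "ldt_depth T \<le> 3 * (2 * n * d + g) + 3 * (n div d + 1) * (n + g)"
      unfolding g_def by blast
    have "real (ldt_depth T) \<le> real (3 * (2 * n * d + g) + 3 * (n div d + 1) * (n + g))"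
      using T(2) by (simp only: of_nat_le_iff)
    also have "\<dots> = 6 * (real n * real d) + 3 * real g + 3 * (real (n div d + 1) * real (n + g))"
      by (simp add: algebra_simps)
    \<comment> \<open>450 = 6 * 2 + 3 * 48 + 3 * 98, where \<open>nL\<close> brings \<open>g\<close>
      under the bound.\<close>
    also have "\<dots> \<le> 450 * (real n * s)" using rg nd g nL by linarith
    finally have "real (ldt_depth T) \<le> 450 * real n * sqrt (real n * log 2 (real n))"
      by (simp add: s_def L_def)
    then show "\<exists>T. ldt_computes n T (median_minus_conv n) \<and>
        real (ldt_depth T) \<le> 450 * real n * sqrt (real n * log 2 (real n))" using T(1) by blast
  qed
qed simp

end
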